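(* Let $\mathcal{X}\subset\mathbb{R}^n$ be closed, let $f,g_1,\dots,g_q:\mathbb{R}^n\to\mathbb{R}$, and let $x^*$ be a local minimizer of the problem $\min_{x\in\mathcal{X}} f(x)$ subject to $g_j(x)\le 0$, $j=1,\dots,q$. Assume that: (i) $f,g_1,\dots,g_q$ are locally Lipschitz and tangentially convex in a neighbourhood of $x^*$, and the contingent tangent cone $T_{\mathcal{X}}(x^* )$ is convex; (ii) $f$ and each $g_j$ are Clarke regular at $x^*$; (iii) the normal cone mapping $x\mapsto N_{\mathcal{X}}(x)$ is outer semicontinuous at $x^*$. Then $x^*$ satisfies the enhanced T-Fritz--John condition: there exist multipliers $\mu_0,\mu_1,\dots,\mu_q\ge 0$ with $(\mu_0,\mu_1,\dots,\mu_q)\ne 0$ and vectors $\xi_f\in\partial_T f(x^* )$, $\xi_j\in\partial_T g_j(x^* )$ ($j=1,\dots,q$), $\eta\in N_{\mathcal{X}}(x^* )$ such that $$0=\mu_0\xi_f+\sum_{j=1}^q\mu_j\xi_j+\eta\qquad\text{and}\qquad \mu_jg_j(x^* )=0,\quad j=1,\dots,q.$$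
   Context: For $h:\mathbb{R}^n\to\mathbb{R}\cup\{+\infty\}$ and $\bar x\in\operatorname{dom}h$, the directional derivative is $h'(\bar x;v):=\lim_{t\downarrow 0}\frac{h(\bar x+tv)-h(\bar x)}{t}$ whenever the limit exists. $h$ is tangentially convex at $\bar x$ if $h'(\bar x;v)$ exists and is finite for every $v\in\mathbb{R}^n$ and $v\mapsto h'(\bar x;v)$ is convex. The tangential subdifferential is $\partial_T h(\bar x):=\{\xi\in\mathbb{R}^n:\langle\xi,v\rangle\le h'(\bar x;v)\ \forall v\in\mathbb{R}^n\}$. A locally Lipschitz $h$ is Clarke regular at $\bar x$ if $h'(\bar x;v)$ exists and equals the Clarke directional derivative $h^\circ(\bar x;v)$ for all $v$. For nonempty $S\subset\mathbb{R}^n$ and $\bar x\in S$: the contingent tangent cone is $T_S(\bar x):=\{d:\exists t_k\downarrow 0,\ d_k\to d\text{ with }\bar x+t_kd_k\in S\}$; the Fréchet normal cone $\widehat N_S(x)$ (for $x\in S$) is $\{\xi:\limsup_{y\to x,\,y\in S,\,y\ne x}\langle\xi,y-x\rangle/\|y-x\|\le 0\}$; the limiting normal cone is $N_S(\bar x):=\{\xi:\exists x^k\to\bar x\ (x^k\in S),\ \xi^k\to\xi,\ \xi^k\in\widehat N_S(x^k)\}$. A multifunction $M$ is outer semicontinuous at $x^*$ if $x^k\to x^*$, $\xi^k\in M(x^k)$, $\xi^k\to\xi$ imply $\xi\in M(x^* )$. *)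

theory Defs
  imports "HOL-Analysis.Analysis"
begin

definition has_dir_deriv ::
  "('a::real_normed_vector \<Rightarrow> real) \<Rightarrow> 'a \<Rightarrow> 'a \<Rightarrow> real \<Rightarrow> bool" where
  "has_dir_deriv h x v D \<longleftrightarrow>
     ((\<lambda>t. (h (x + t *\<^sub>R v) - h x) / t) \<longlongrightarrow> D) (at_right 0)"

(* Lim is unspecified when no real limit exists, so tangential convexity and Clarke regularity
   demand existence explicitly; the tangential subdifferential presupposes it. *)
definition dir_deriv :: "('a::real_normed_vector \<Rightarrow> real) \<Rightarrow> 'a \<Rightarrow> 'a \<Rightarrow> real" where
  "dir_deriv h x v = Lim (at_right 0) (\<lambda>t. (h (x + t *\<^sub>R v) - h x) / t)"

definition tangentially_convex_at :: "('a::real_normed_vector \<Rightarrow> real) \<Rightarrow> 'a \<Rightarrow> bool" where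
  "tangentially_convex_at h x \<longleftrightarrow>
     (\<forall>v. \<exists>D. has_dir_deriv h x v D) \<and> convex_on UNIV (\<lambda>v. dir_deriv h x v)"

definition tangential_subdiff :: "('a::real_inner \<Rightarrow> real) \<Rightarrow> 'a \<Rightarrow> 'a set" where
  "tangential_subdiff h x = {\<xi>. \<forall>v. \<xi> \<bullet> v \<le> dir_deriv h x v}"

definition locally_lipschitz_at :: "('a::metric_space \<Rightarrow> real) \<Rightarrow> 'a \<Rightarrow> bool" where
  "locally_lipschitz_at h x \<longleftrightarrow> (\<exists>\<epsilon>>0. \<exists>L. L-lipschitz_on (ball x \<epsilon>) h)"

(* The upper limit over y \<rightarrow> x (y = x allowed) and t \<down> 0, taken in the extended reals. *)
definition clarke_dir_deriv :: "('a::real_normed_vector \<Rightarrow> real) \<Rightarrow> 'a \<Rightarrow> 'a \<Rightarrow> ereal" where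
  "clarke_dir_deriv h x v =
     Limsup (nhds x \<times>\<^sub>F at_right 0) (\<lambda>(y, t). ereal ((h (y + t *\<^sub>R v) - h y) / t))"

definition clarke_regular_at :: "('a::real_normed_vector \<Rightarrow> real) \<Rightarrow> 'a \<Rightarrow> bool" where
  "clarke_regular_at h x \<longleftrightarrow>
     locally_lipschitz_at h x \<and>
     (\<forall>v. (\<exists>D. has_dir_deriv h x v D) \<and> ereal (dir_deriv h x v) = clarke_dir_deriv h x v)"

definition contingent_cone :: "'a::real_normed_vector set \<Rightarrow> 'a \<Rightarrow> 'a set" where
  "contingent_cone S x =
     {d. \<exists>t e. (\<forall>k::nat. t k > 0) \<and> t \<longlonglongrightarrow> (0::real) \<and> e \<longlonglongrightarrow> d \<and>
               (\<forall>k. x + t k *\<^sub>R e k \<in> S)}"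

(* At an isolated point of S the filter is trivial and the upper limit is -\<infinity>, so every
   vector is normal. *)
definition frechet_normal_cone :: "'a::real_inner set \<Rightarrow> 'a \<Rightarrow> 'a set" where
  "frechet_normal_cone S x =
     {\<xi>. Limsup (at x within S) (\<lambda>y. ereal (\<xi> \<bullet> (y - x) / norm (y - x))) \<le> 0}"

(* For closed S this is empty at points outside S. *)
definition limiting_normal_cone :: "'a::real_inner set \<Rightarrow> 'a \<Rightarrow> 'a set" where
  "limiting_normal_cone S x =
     {\<xi>. \<exists>y \<zeta>. (\<forall>k::nat. y k \<in> S) \<and> y \<longlonglongrightarrow> x \<and> \<zeta> \<longlonglongrightarrow> \<xi> \<and>
               (\<forall>k. \<zeta> k \<in> frechet_normal_cone S (y k))}"

definition outer_semicontinuous_at ::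
  "('a::topological_space \<Rightarrow> 'b::topological_space set) \<Rightarrow> 'a \<Rightarrow> bool" where
  "outer_semicontinuous_at M x \<longleftrightarrow>
     (\<forall>y \<zeta> \<xi>. y \<longlonglongrightarrow> x \<longrightarrow> (\<forall>k::nat. \<zeta> k \<in> M (y k)) \<longrightarrow> \<zeta> \<longlonglongrightarrow> \<xi> \<longrightarrow> \<xi> \<in> M x)"

definition local_minimizer_on :: "('a::metric_space \<Rightarrow> real) \<Rightarrow> 'a set \<Rightarrow> 'a \<Rightarrow> bool" where
  "local_minimizer_on f C x \<longleftrightarrow> x \<in> C \<and> (\<exists>\<epsilon>>0. \<forall>y \<in> C \<inter> ball x \<epsilon>. f x \<le> f y)"

end

theory Submission
  imports Defs
begin

text \<open>
  Local minimality and the Lipschitz property rule out a contingent direction along which \<open>f\<close> and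
  all active constraints have negative directional derivative. Each directional derivative is the
  support function of the compact tangential subdifferential, so if the convex hull \<open>K\<close> of the
  active subdifferentials missed the negative of the polar of the contingent cone, a hyperplane
  separating the two sets would, by the bipolar theorem, yield such a direction in the closure of
  the cone. A common point writes minus a convex combination of active subgradients as an element
  of the polar, which consists of Frechet normals, hence of limiting normals.
\<close>

section \<open>Directional derivatives of tangentially convex functions\<close>

lemma tangentially_convex_at_tendsto:
  assumes "tangentially_convex_at h x"
  shows "((\<lambda>t. (h (x + t *\<^sub>R v) - h x) / t) \<longlongrightarrow> dir_deriv h x v) (at_right 0)"
proof -
  obtain D where D: "((\<lambda>t. (h (x + t *\<^sub>R v) - h x) / t) \<longlongrightarrow> D) (at_right 0)"
    using assms by (auto simp: tangentially_convex_at_def has_dir_deriv_def)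
  then have "dir_deriv h x v = D"
    unfolding dir_deriv_def by (intro tendsto_Lim) auto
  with D show ?thesis by simp
qed

lemma dir_deriv_scaleR:
  assumes "tangentially_convex_at h x" and "c > 0"
  shows "dir_deriv h x (c *\<^sub>R v) = c * dir_deriv h x v"
proof -
  let ?Q = "\<lambda>t. (h (x + t *\<^sub>R v) - h x) / t"
  \<comment> \<open>Since \<open>c > 0\<close>, the substitution of \<open>c * t\<close> for
    \<open>t\<close> preserves the limit from the right at 0.\<close>
  have "((\<lambda>t. c * t) \<longlongrightarrow> c * 0) (at_right 0)"
    by (intro tendsto_intros)
  then have "filterlim (\<lambda>t. c * t) (at_right 0) (at_right 0)"
    using \<open>c > 0\<close> by (auto simp: filterlim_at eventually_at_filter)
  from filterlim_compose[OF tangentially_convex_at_tendsto[OF assms(1)] this]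
  have "((\<lambda>t. c * ?Q (c * t)) \<longlongrightarrow> c * dir_deriv h x v) (at_right 0)"
    by (intro tendsto_intros)
  moreover have "(\<lambda>t. c * ?Q (c * t)) = (\<lambda>t. (h (x + t *\<^sub>R c *\<^sub>R v) - h x) / t)"
    using \<open>c > 0\<close> by (auto simp: mult.commute)
  ultimately show ?thesis
    using tangentially_convex_at_tendsto[OF assms(1), of "c *\<^sub>R v"]
    by (intro tendsto_unique[of "at_right 0"]) auto
qed

lemma dir_deriv_zero:
  assumes "tangentially_convex_at h x"
  shows "dir_deriv h x 0 = 0"
  using dir_deriv_scaleR[OF assms, of 2 0] by simp

lemma dir_deriv_add_le:
  assumes "tangentially_convex_at h x"
  shows "dir_deriv h x (v + w) \<le> dir_deriv h x v + dir_deriv h x w"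
proof -
  have "convex_on UNIV (dir_deriv h x)"
    using assms by (simp add: tangentially_convex_at_def)
  \<comment> \<open>The midpoint of the doubled vectors is \<open>v + w\<close>; homogeneity cancels
    the factors 2 and 1/2.\<close>
  from convex_onD[OF this, of "1/2" "2 *\<^sub>R v" "2 *\<^sub>R w"] show ?thesis
    using dir_deriv_scaleR[OF assms, of 2] by simp
qed

text \<open>The Lipschitz bound on difference quotients passes to the limit. It makes the tangential
  subdifferential bounded.\<close>

lemma dir_deriv_le_norm:
  assumes "locally_lipschitz_at h x" and "tangentially_convex_at h x"
  obtains L where "\<And>v. dir_deriv h x v \<le> L * norm v"
proof -
  obtain \<epsilon> L where "\<epsilon> > 0" and L: "L-lipschitz_on (ball x \<epsilon>) h"
    using assms(1) by (auto simp: locally_lipschitz_at_def)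
  have "dir_deriv h x v \<le> L * norm v" for v
  proof (rule tendsto_upperbound[OF tangentially_convex_at_tendsto[OF assms(2)]])
    have "((\<lambda>t. x + t *\<^sub>R v) \<longlongrightarrow> x + 0 *\<^sub>R v) (at_right 0)"
      by (intro tendsto_intros)
    then have "\<forall>\<^sub>F t in at_right 0. x + t *\<^sub>R v \<in> ball x \<epsilon>"
      using \<open>\<epsilon> > 0\<close> by (intro topological_tendstoD) auto
    moreover have "\<forall>\<^sub>F t in at_right 0. t > (0::real)"
      by (simp add: eventually_at_filter)
    ultimately show "\<forall>\<^sub>F t in at_right 0. (h (x + t *\<^sub>R v) - h x) / t \<le> L * norm v"
    proof eventually_elim
      case (elim t)
      have "h (x + t *\<^sub>R v) - h x \<le> L * (t * norm v)"
        using lipschitz_onD[OF L elim(1), of x] \<open>\<epsilon> > 0\<close> elim(2) by (simp add: dist_norm)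
      then show ?case
        using elim(2) by (simp add: field_simps)
    qed
  qed simp
  then show ?thesis ..
qed

lemma locally_lipschitz_at_isCont:
  assumes "locally_lipschitz_at h x"
  shows "isCont h x"
proof -
  obtain \<epsilon> L where "\<epsilon> > 0" and "L-lipschitz_on (ball x \<epsilon>) h"
    using assms by (auto simp: locally_lipschitz_at_def)
  then show ?thesis
    using continuous_on_eq_continuous_at[of "ball x \<epsilon>" h] lipschitz_on_continuous_on by auto
qed

text \<open>The Lipschitz property lets the direction vary with the step: replacing
  \<open>e k\<close> by \<open>d\<close> changes the quotient by at most
  \<open>L * norm (e k - d)\<close>, which tends to 0. Contingent directions come with such varying
  \<open>e k\<close>.\<close>

lemma difference_quotient_tendsto_dir_deriv:
  assumes "locally_lipschitz_at h x" and "tangentially_convex_at h x"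
    and t_pos: "\<And>k::nat. t k > 0" and t: "t \<longlonglongrightarrow> 0" and e: "e \<longlonglongrightarrow> d"
  shows "(\<lambda>k. (h (x + t k *\<^sub>R e k) - h x) / t k) \<longlonglongrightarrow> dir_deriv h x d"
proof -
  obtain \<epsilon> L where "\<epsilon> > 0" and L: "L-lipschitz_on (ball x \<epsilon>) h"
    using assms(1) by (auto simp: locally_lipschitz_at_def)
  have "filterlim t (at_right 0) sequentially"
    using t t_pos by (simp add: filterlim_at less_imp_neq[symmetric])
  then have lim: "(\<lambda>k. (h (x + t k *\<^sub>R d) - h x) / t k) \<longlonglongrightarrow> dir_deriv h x d"
    by (rule filterlim_compose[OF tangentially_convex_at_tendsto[OF assms(2)]])
  have "(\<lambda>k. x + t k *\<^sub>R e k) \<longlonglongrightarrow> x + 0 *\<^sub>R d" "(\<lambda>k. x + t k *\<^sub>R d) \<longlonglongrightarrow> x + 0 *\<^sub>R d"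
    by (intro tendsto_intros t e)+
  then have "\<forall>\<^sub>F k in sequentially. x + t k *\<^sub>R e k \<in> ball x \<epsilon>"
    and "\<forall>\<^sub>F k in sequentially. x + t k *\<^sub>R d \<in> ball x \<epsilon>"
    using \<open>\<epsilon> > 0\<close> by (auto dest!: topological_tendstoD[OF _ open_ball] simp del: mem_ball)
  then have bound: "\<forall>\<^sub>F k in sequentially.
      norm ((h (x + t k *\<^sub>R e k) - h x) / t k - (h (x + t k *\<^sub>R d) - h x) / t k)
        \<le> L * norm (e k - d)"
  proof eventually_elim
    case (elim k)
    have "\<bar>h (x + t k *\<^sub>R e k) - h (x + t k *\<^sub>R d)\<bar> \<le> L * (t k * norm (e k - d))"
      using lipschitz_onD[OF L elim] t_pos[of k]
      by (simp add: dist_norm flip: scaleR_diff_right)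
    then show ?case
      using t_pos[of k] by (simp add: diff_divide_distrib[symmetric] field_simps)
  qed
  have "(\<lambda>k. L * norm (e k - d)) \<longlonglongrightarrow> L * norm (d - d)"
    by (intro tendsto_intros e)
  then have "(\<lambda>k. L * norm (e k - d)) \<longlonglongrightarrow> 0" by simp
  from tendsto_add[OF Lim_null_comparison[OF bound this] lim] show ?thesis by simp
qed

section \<open>Subgradients and the tangential subdifferential\<close>

lemma convex_on_subgradient:
  fixes p :: "'a::euclidean_space \<Rightarrow> real"
  assumes p: "convex_on UNIV p"
  obtains \<xi> where "\<And>x. p d + \<xi> \<bullet> (x - d) \<le> p x"
proof -
  \<comment> \<open>The strict epigraph is convex and misses the graph point over \<open>d\<close>.
    A hyperplane with normal \<open>(u, s)\<close> separating the two yields the subgradient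
    \<open>- u /\<^sub>R s\<close> once \<open>s > 0\<close> is known.\<close>
  let ?S = "{(x, r). p x < r}"
  have "convex ?S"
  proof (rule convexI)
    fix y z :: "'a \<times> real" and u v :: real
    assume yz: "y \<in> ?S" "z \<in> ?S" and uv: "0 \<le> u" "0 \<le> v" "u + v = 1"
    have "p (u *\<^sub>R fst y + v *\<^sub>R fst z) \<le> u * p (fst y) + v * p (fst z)"
      using p uv by (auto simp: convex_on_def)
    also have "\<dots> < u * snd y + v * snd z"
    proof (cases "u = 0")
      case False
      then have "u * p (fst y) < u * snd y" "v * p (fst z) \<le> v * snd z"
        using yz uv by (auto intro!: mult_left_mono)
      then show ?thesis by linarith
    qed (use yz uv in auto)
    finally show "u *\<^sub>R y + v *\<^sub>R z \<in> ?S"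
      by (simp add: case_prod_beta)
  qed
  moreover have "(d, p d + 1) \<in> ?S" by simp
  then have "?S \<noteq> {}" by blast
  moreover have "{(d, p d)} \<inter> ?S = {}" by simp
  ultimately obtain a b where "a \<noteq> 0" and ab: "a \<bullet> (d, p d) \<le> b" "\<And>y. y \<in> ?S \<Longrightarrow> b \<le> a \<bullet> y"
    using separating_hyperplane_sets[of "{(d, p d)}" ?S]
    by (metis convex_singleton insert_iff insert_not_empty)
  obtain u s where a: "a = (u, s)" by (cases a)
  have sep: "u \<bullet> d + s * p d \<le> u \<bullet> x + s * r" if "p x < r" for x r
    using ab(1) ab(2)[of "(x, r)"] that by (auto simp: a)
  have "s \<ge> 0"
    using sep[of d "p d + 1"] by (simp add: algebra_simps)
  \<comment> \<open>The hyperplane is not vertical: \<open>p\<close> is finite everywhere, so the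
    separation may be tested at \<open>d - u\<close>, which forces \<open>u = 0\<close>.\<close>
  moreover have "s \<noteq> 0"
  proof
    assume "s = 0"
    with sep[of "d - u" "p (d - u) + 1"] have "u \<bullet> u \<le> 0"
      by (simp add: inner_diff_right)
    with \<open>s = 0\<close> \<open>a \<noteq> 0\<close> show False
      by (simp add: a zero_prod_def flip: inner_gt_zero_iff)
  qed
  ultimately have "s > 0" by simp
  have "p d + (- u /\<^sub>R s) \<bullet> (x - d) \<le> p x" for x
  \<comment> \<open>Separation is available only strictly above the graph; \<open>r\<close> is let
    down to \<open>p x\<close>.\<close>
  proof (rule dense_ge)
    fix r assume "p x < r"
    from sep[OF this] \<open>s > 0\<close> show "p d + (- u /\<^sub>R s) \<bullet> (x - d) \<le> r"
      by (simp add: inner_diff_right field_simps)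
  qed
  then show ?thesis ..
qed

text \<open>A subgradient of the directional derivative at \<open>d\<close> works: subadditivity
  turns its inequality into a bound in every direction, and testing it at 0 gives equality at
  \<open>d\<close>.\<close>

lemma tangential_subdiff_attains_dir_deriv:
  fixes h :: "'a::euclidean_space \<Rightarrow> real"
  assumes h: "tangentially_convex_at h x"
  obtains \<xi> where "\<xi> \<in> tangential_subdiff h x" and "\<xi> \<bullet> d = dir_deriv h x d"
proof -
  have "convex_on UNIV (dir_deriv h x)"
    using h by (simp add: tangentially_convex_at_def)
  then obtain \<xi> where \<xi>: "\<And>v. dir_deriv h x d + \<xi> \<bullet> (v - d) \<le> dir_deriv h x v"
    by (rule convex_on_subgradient[where d = d]) blast
  have le: "\<xi> \<bullet> w \<le> dir_deriv h x w" for w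
    using \<xi>[of "d + w"] dir_deriv_add_le[OF h, of d w] by simp
  moreover have "\<xi> \<bullet> d = dir_deriv h x d"
    using \<xi>[of 0] le[of d] dir_deriv_zero[OF h] by simp
  ultimately show ?thesis
    by (intro that[of \<xi>]) (auto simp: tangential_subdiff_def)
qed

text \<open>As an intersection of closed half-spaces the set is visibly convex and closed.\<close>

lemma tangential_subdiff_eq_Inter:
  "tangential_subdiff h x = (\<Inter>v. {\<xi>. v \<bullet> \<xi> \<le> dir_deriv h x v})"
  by (auto simp: tangential_subdiff_def inner_commute)

lemma convex_tangential_subdiff: "convex (tangential_subdiff h x)"
  unfolding tangential_subdiff_eq_Inter by (intro convex_INT convex_halfspace_le)

lemma compact_tangential_subdiff:
  fixes h :: "'a::euclidean_space \<Rightarrow> real"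
  assumes "locally_lipschitz_at h x" and "tangentially_convex_at h x"
  shows "compact (tangential_subdiff h x)"
proof -
  obtain L where L: "\<And>v. dir_deriv h x v \<le> L * norm v"
    using dir_deriv_le_norm[OF assms] by blast
  \<comment> \<open>The vector \<xi> is tested against itself as direction. The absolute value
    covers \<xi> = 0, since the sign of \<open>L\<close> is not recorded.\<close>
  have "norm \<xi> \<le> \<bar>L\<bar>" if "\<xi> \<in> tangential_subdiff h x" for \<xi>
  proof (cases "\<xi> = 0")
    case False
    have "norm \<xi> * norm \<xi> \<le> L * norm \<xi>"
      using that L[of \<xi>] by (auto simp: tangential_subdiff_def norm_eq_sqrt_inner intro: order_trans)
    with False show ?thesis by simp
  qed simp
  then have "bounded (tangential_subdiff h x)"
    unfolding bounded_iff by blast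
  moreover have "closed (tangential_subdiff h x)"
    unfolding tangential_subdiff_eq_Inter by (intro closed_INT ballI closed_halfspace_le)
  ultimately show ?thesis
    by (simp add: compact_eq_bounded_closed)
qed

section \<open>The contingent cone and its polar\<close>

lemma zero_in_contingent_cone:
  assumes "x \<in> S"
  shows "0 \<in> contingent_cone S x"
  unfolding contingent_cone_def mem_Collect_eq using assms LIMSEQ_inverse_real_of_nat
  by (intro exI[of _ "\<lambda>k. inverse (real (Suc k))"] exI[of _ "\<lambda>_. 0"]) auto

text \<open>Multiplying the directions by \<open>c\<close> is offset by dividing the steps by
  \<open>c\<close>. The factor 0, which \<open>cone\<close> allows, is treated separately.\<close>

lemma cone_contingent_cone:
  assumes "x \<in> S"
  shows "cone (contingent_cone S x)"
  unfolding cone_def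
proof (intro ballI allI impI)
  fix d and c :: real
  assume d: "d \<in> contingent_cone S x" and "0 \<le> c"
  show "c *\<^sub>R d \<in> contingent_cone S x"
  proof (cases "c = 0")
    case True
    then show ?thesis using zero_in_contingent_cone[OF assms] by simp
  next
    case False
    with \<open>0 \<le> c\<close> have "c > 0" by simp
    obtain t e where te: "\<And>k::nat. t k > 0" "t \<longlonglongrightarrow> 0" "e \<longlonglongrightarrow> d" "\<And>k. x + t k *\<^sub>R e k \<in> S"
      using d by (auto simp: contingent_cone_def)
    have "(\<lambda>k. t k / c) \<longlonglongrightarrow> 0 / c" "(\<lambda>k. c *\<^sub>R e k) \<longlonglongrightarrow> c *\<^sub>R d"
      using \<open>c > 0\<close> by (intro tendsto_intros te; simp)+
    then show ?thesis
      unfolding contingent_cone_def using te \<open>c > 0\<close>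
      by (auto intro!: exI[of _ "\<lambda>k. t k / c"] exI[of _ "\<lambda>k. c *\<^sub>R e k"])
  qed
qed

text \<open>If the normal quotient stayed at least \<open>c > 0\<close> along points of
  \<open>S\<close> tending to \<open>x\<close>, compactness of the unit sphere would make a
  subsequence of the normalized differences converge to a contingent direction \<open>d\<close> with
  \<eta> \<bullet> d \<ge> c.\<close>

lemma polar_contingent_cone_subset_frechet_normal_cone:
  fixes S :: "'a::euclidean_space set"
  assumes \<eta>: "\<And>d. d \<in> contingent_cone S x \<Longrightarrow> \<eta> \<bullet> d \<le> 0"
  shows "\<eta> \<in> frechet_normal_cone S x"
proof -
  let ?Q = "\<lambda>y. \<eta> \<bullet> (y - x) / norm (y - x)"
  have ev: "\<forall>\<^sub>F y in at x within S. ?Q y < c" if "c > 0" for c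
  proof (rule ccontr)
    assume neg: "\<not> ?thesis"
    have "\<exists>y\<in>S. y \<noteq> x \<and> dist y x < inverse (real (Suc k)) \<and> c \<le> ?Q y" for k
    proof -
      have "inverse (real (Suc k)) > 0" by simp
      then show ?thesis
        using neg unfolding eventually_at by (meson not_le)
    qed
    then obtain y where y: "\<And>k. y k \<in> S" "\<And>k. y k \<noteq> x"
        "\<And>k. dist (y k) x < inverse (real (Suc k))" "\<And>k. c \<le> ?Q (y k)"
      by metis
    define t where "t k = norm (y k - x)" for k
    define e where "e k = (y k - x) /\<^sub>R t k" for k
    have t_pos: "t k > 0" for k
      using y(2) by (simp add: t_def)
    have "norm (t k) \<le> inverse (real (Suc k))" for k
      using y(3)[of k] by (simp only: t_def dist_norm real_norm_def abs_norm_cancel less_imp_le)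
    then have "t \<longlonglongrightarrow> 0"
      by (intro Lim_null_comparison[OF always_eventually LIMSEQ_inverse_real_of_nat]) blast
    moreover have "e k \<in> sphere 0 1" for k
      using t_pos[of k] by (simp add: e_def t_def)
    then obtain d r where r: "strict_mono (r :: nat \<Rightarrow> nat)" "(e \<circ> r) \<longlonglongrightarrow> d"
      using compact_sphere[of "0::'a" 1] unfolding compact_def by metis
    moreover have "x + t k *\<^sub>R e k = y k" for k
      using t_pos[of k] by (simp add: e_def)
    ultimately have "d \<in> contingent_cone S x"
      unfolding contingent_cone_def using t_pos y(1)
      by (auto simp: LIMSEQ_subseq_LIMSEQ intro!: exI[of _ "t \<circ> r"] exI[of _ "e \<circ> r"])
    then have "\<eta> \<bullet> d \<le> 0" by (rule \<eta>)
    moreover have "(\<lambda>k. \<eta> \<bullet> (e \<circ> r) k) \<longlonglongrightarrow> \<eta> \<bullet> d"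
      by (intro tendsto_intros r)
    moreover have "c \<le> \<eta> \<bullet> (e \<circ> r) k" for k
      using y(4)[of "r k"] by (simp add: e_def t_def divide_inverse mult.commute)
    ultimately show False
      using \<open>c > 0\<close> by (meson LIMSEQ_le_const order_trans not_le)
  qed
  have "Limsup (at x within S) (\<lambda>y. ereal (?Q y)) \<le> 0"
  proof (rule ereal_le_epsilon2)
    fix c :: real assume "c > 0"
    from ev[OF this] have "\<forall>\<^sub>F y in at x within S. ereal (?Q y) \<le> 0 + ereal c"
      by eventually_elim simp
    then show "Limsup (at x within S) (\<lambda>y. ereal (?Q y)) \<le> 0 + ereal c"
      by (rule Limsup_bounded)
  qed
  then show ?thesis by (simp add: frechet_normal_cone_def)
qed

lemma frechet_subset_limiting_normal_cone:
  assumes "x \<in> S"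
  shows "frechet_normal_cone S x \<subseteq> limiting_normal_cone S x"
  \<comment> \<open>Constant sequences serve as witnesses.\<close>
  unfolding limiting_normal_cone_def using assms by (auto intro!: exI[of _ "\<lambda>_. _"])

section \<open>Separation and polarity of convex cones\<close>

lemma closure_convex_cone_bipolar:
  fixes T :: "'a::euclidean_space set"
  assumes "convex T" "cone T" "T \<noteq> {}"
    and d: "\<And>\<eta>. (\<And>v. v \<in> T \<Longrightarrow> \<eta> \<bullet> v \<le> 0) \<Longrightarrow> \<eta> \<bullet> d \<le> 0"
  shows "d \<in> closure T"
proof (rule ccontr)
  assume "d \<notin> closure T"
  then obtain a b where ab: "a \<bullet> d < b" "\<And>v. v \<in> closure T \<Longrightarrow> b < a \<bullet> v"
    using separating_hyperplane_closed_point[of "closure T" d] \<open>convex T\<close> convex_closure by auto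
  have "0 \<in> T" using assms(2,3) cone_contains_0 by blast
  then have "b < 0" using ab(2)[of 0] closure_subset by auto
  \<comment> \<open>A vector of \<open>T\<close> with negative product could be rescaled so that the
    product is exactly \<open>b\<close>, against the strict separation. Hence \<open>- a\<close>
    lies in the polar of \<open>T\<close>.\<close>
  have "0 \<le> a \<bullet> v" if "v \<in> T" for v
  proof (rule ccontr)
    assume "\<not> 0 \<le> a \<bullet> v"
    then have neg: "a \<bullet> v < 0" by simp
    have "(b / (a \<bullet> v)) *\<^sub>R v \<in> T"
      using \<open>cone T\<close> \<open>v \<in> T\<close> neg \<open>b < 0\<close> by (intro mem_cone) (auto simp: divide_nonpos_neg)
    then have "b < a \<bullet> ((b / (a \<bullet> v)) *\<^sub>R v)"
      using ab(2) closure_subset by blast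
    with neg show False by simp
  qed
  then have "- a \<bullet> d \<le> 0" by (intro d) simp
  with ab(1) \<open>b < 0\<close> show False by simp
qed

lemma compact_convex_meets_neg_polar:
  fixes T K :: "'a::euclidean_space set"
  assumes T: "convex T" "cone T" "T \<noteq> {}" and K: "convex K" "compact K"
    and sup: "\<And>d. d \<in> closure T \<Longrightarrow> \<exists>k\<in>K. 0 \<le> k \<bullet> d"
  obtains k where "k \<in> K" and "\<And>v. v \<in> T \<Longrightarrow> - k \<bullet> v \<le> 0"
proof (rule ccontr)
  assume "\<not> thesis"
  \<comment> \<open>This is the negative of the polar of \<open>T\<close>, so a point of
    \<open>K\<close> in it is what is sought.\<close>
  let ?P = "\<Inter>v\<in>T. {\<eta>. v \<bullet> \<eta> \<ge> 0}"
  have "K \<inter> ?P = {}"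
    using \<open>\<not> thesis\<close> that by (fastforce simp: inner_commute)
  moreover have "closed ?P"
    by (intro closed_INT ballI closed_halfspace_ge)
  moreover have "convex ?P"
    by (intro convex_INT convex_halfspace_ge)
  moreover have "0 \<in> ?P" by simp
  moreover have "K \<noteq> {}"
    using sup[of 0] T cone_contains_0 closure_subset by blast
  ultimately obtain a b where ab: "\<And>k. k \<in> K \<Longrightarrow> a \<bullet> k < b" "\<And>\<eta>. \<eta> \<in> ?P \<Longrightarrow> b < a \<bullet> \<eta>"
    using separating_hyperplane_compact_closed[of K ?P] K by blast
  \<comment> \<open>Thus \<open>a\<close> has negative product with every point of \<open>K\<close>;
    membership in \<open>closure T\<close> would contradict \<open>sup\<close>.\<close>
  have "b < 0" using ab(2)[of 0] by simp
  have "a \<in> closure T"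
  proof (rule closure_convex_cone_bipolar[OF T])
    fix \<eta> assume \<eta>: "\<And>v. v \<in> T \<Longrightarrow> \<eta> \<bullet> v \<le> 0"
    show "\<eta> \<bullet> a \<le> 0"
    proof (rule ccontr)
      assume "\<not> \<eta> \<bullet> a \<le> 0"
      then have pos: "\<eta> \<bullet> a > 0" by simp
      \<comment> \<open>The factor is negative, which moves \<eta> from the polar into
        \<open>?P\<close>, and its size makes the product with \<open>a\<close> equal to
        \<open>b\<close>.\<close>
      have "(b / (\<eta> \<bullet> a)) *\<^sub>R \<eta> \<in> ?P"
        using \<eta> pos \<open>b < 0\<close>
        by (auto simp: inner_commute[of _ \<eta>] intro!: divide_nonneg_pos mult_nonpos_nonpos)
      from ab(2)[OF this] pos show False by (simp add: inner_commute)
    qed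
  qed
  with sup obtain k where "k \<in> K" "0 \<le> k \<bullet> a" by blast
  with ab(1)[of k] \<open>b < 0\<close> show False by (simp add: inner_commute)
qed

section \<open>Descent directions and the multiplier rule\<close>

lemma no_common_descent_direction:
  fixes f :: "'a::real_normed_vector \<Rightarrow> real"
  assumes min: "local_minimizer_on f {y \<in> X. \<forall>j\<in>J. g j y \<le> 0} x" and "finite J"
    and f: "locally_lipschitz_at f x" "tangentially_convex_at f x"
    and g: "\<And>j. j \<in> J \<Longrightarrow> locally_lipschitz_at (g j) x"
           "\<And>j. j \<in> J \<Longrightarrow> tangentially_convex_at (g j) x"
    and d: "d \<in> contingent_cone X x"
    and f_desc: "dir_deriv f x d < 0"
    and g_desc: "\<And>j. j \<in> J \<Longrightarrow> g j x = 0 \<Longrightarrow> dir_deriv (g j) x d < 0"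
  shows False
proof -
  obtain \<epsilon> where "\<epsilon> > 0" and x_feas: "\<And>j. j \<in> J \<Longrightarrow> g j x \<le> 0"
    and f_min: "\<And>y. y \<in> X \<Longrightarrow> \<forall>j\<in>J. g j y \<le> 0 \<Longrightarrow> y \<in> ball x \<epsilon> \<Longrightarrow> f x \<le> f y"
    using min by (auto simp: local_minimizer_on_def)
  obtain t e where te: "\<And>k::nat. t k > 0" "t \<longlonglongrightarrow> 0" "e \<longlonglongrightarrow> d" and X: "\<And>k. x + t k *\<^sub>R e k \<in> X"
    using d by (auto simp: contingent_cone_def)
  have "(\<lambda>k. x + t k *\<^sub>R e k) \<longlonglongrightarrow> x + 0 *\<^sub>R d"
    by (intro tendsto_intros te)
  then have lim: "(\<lambda>k. x + t k *\<^sub>R e k) \<longlonglongrightarrow> x" by simp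
  have decrease: "\<forall>\<^sub>F k in sequentially. h (x + t k *\<^sub>R e k) < h x"
    if "locally_lipschitz_at h x" "tangentially_convex_at h x" "dir_deriv h x d < 0" for h
    using order_tendstoD(2)[OF difference_quotient_tendsto_dir_deriv[OF that(1,2) te] that(3)]
  proof eventually_elim
    case (elim k)
    then show ?case using te(1)[of k] by (simp add: divide_less_0_iff)
  qed
  \<comment> \<open>Active constraints decrease from the value 0; inactive ones stay negative by
    continuity.\<close>
  have "\<forall>\<^sub>F k in sequentially. g j (x + t k *\<^sub>R e k) \<le> 0" if "j \<in> J" for j
  proof (cases "g j x = 0")
    case True
    from decrease[OF g[OF \<open>j \<in> J\<close>] g_desc[OF \<open>j \<in> J\<close> True]] show ?thesis
      by eventually_elim (simp add: True)
  next
    case False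
    with x_feas[OF \<open>j \<in> J\<close>] have "g j x < 0" by simp
    have "(\<lambda>k. g j (x + t k *\<^sub>R e k)) \<longlonglongrightarrow> g j x"
      using isCont_tendsto_compose[OF locally_lipschitz_at_isCont[OF g(1)[OF \<open>j \<in> J\<close>]] lim] .
    from order_tendstoD(2)[OF this \<open>g j x < 0\<close>] show ?thesis
      by eventually_elim simp
  qed
  then have "\<forall>\<^sub>F k in sequentially. \<forall>j\<in>J. g j (x + t k *\<^sub>R e k) \<le> 0"
    using \<open>finite J\<close> by (simp add: eventually_ball_finite_distrib)
  moreover have "\<forall>\<^sub>F k in sequentially. x + t k *\<^sub>R e k \<in> ball x \<epsilon>"
    using lim \<open>\<epsilon> > 0\<close> by (intro topological_tendstoD) auto
  ultimately have "\<forall>\<^sub>F k in sequentially. f x \<le> f (x + t k *\<^sub>R e k)"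
    by eventually_elim (use f_min X in blast)
  with decrease[OF f f_desc] have "\<forall>\<^sub>F k::nat in sequentially. False"
    by eventually_elim simp
  then show False by simp
qed

theorem theorem7:
  fixes X :: "(real ^ 'n) set"
    and f :: "real ^ 'n \<Rightarrow> real"
    and g :: "nat \<Rightarrow> real ^ 'n \<Rightarrow> real"
    and q :: nat
    and xstar :: "real ^ 'n"
  assumes "closed X"
    and "local_minimizer_on f {x \<in> X. \<forall>j\<in>{1..q}. g j x \<le> 0} xstar"
    and "\<forall>\<^sub>F x in nhds xstar. locally_lipschitz_at f x \<and> tangentially_convex_at f x"
    and "\<forall>j\<in>{1..q}. \<forall>\<^sub>F x in nhds xstar.
           locally_lipschitz_at (g j) x \<and> tangentially_convex_at (g j) x"
    and "convex (contingent_cone X xstar)"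
    and "clarke_regular_at f xstar"
    and "\<forall>j\<in>{1..q}. clarke_regular_at (g j) xstar"
    and "outer_semicontinuous_at (\<lambda>x. limiting_normal_cone X x) xstar"
  shows "\<exists>(\<mu> :: nat \<Rightarrow> real) \<xi>\<^sub>f (\<xi> :: nat \<Rightarrow> real ^ 'n) \<eta>.
           (\<forall>j\<in>{0..q}. \<mu> j \<ge> 0) \<and> (\<exists>j\<in>{0..q}. \<mu> j \<noteq> 0) \<and>
           \<xi>\<^sub>f \<in> tangential_subdiff f xstar \<and>
           (\<forall>j\<in>{1..q}. \<xi> j \<in> tangential_subdiff (g j) xstar) \<and>
           \<eta> \<in> limiting_normal_cone X xstar \<and>
           0 = \<mu> 0 *\<^sub>R \<xi>\<^sub>f + (\<Sum>j=1..q. \<mu> j *\<^sub>R \<xi> j) + \<eta> \<and>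
           (\<forall>j\<in>{1..q}. \<mu> j * g j xstar = 0)"
proof -
  let ?T = "contingent_cone X xstar"
  \<comment> \<open>The objective takes index 0, so that it is treated uniformly with the
    constraints; \<open>A\<close> collects it and the active constraints.\<close>
  define h where "h i = (if i = 0 then f else g i)" for i
  define A where "A = insert 0 {j\<in>{1..q}. g j xstar = 0}"
  define D where "D i = tangential_subdiff (h i) xstar" for i
  have xX: "xstar \<in> X"
    using assms(2) by (auto simp: local_minimizer_on_def)
  have h_g: "h j = g j" if "j \<in> {1..q}" for j
    using that by (simp add: h_def)
  have reg: "locally_lipschitz_at (h i) xstar" "tangentially_convex_at (h i) xstar"
    if "i \<in> {0..q}" for i
  proof -
    have "\<forall>\<^sub>F x in nhds xstar. locally_lipschitz_at (h i) x \<and> tangentially_convex_at (h i) x"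
      using assms(3,4) that by (simp add: h_def)
    from eventually_nhds_x_imp_x[OF this]
    show "locally_lipschitz_at (h i) xstar" "tangentially_convex_at (h i) xstar" by auto
  qed
  have A: "finite A" "A \<subseteq> {0..q}" "0 \<in> A" by (auto simp: A_def)
  define K where "K = convex hull (\<Union>i\<in>A. D i)"
  have "compact K"
    unfolding K_def D_def using A reg
    by (intro compact_convex_hull compact_UN compact_tangential_subdiff) auto
  have D_ne: "D i \<noteq> {}" if "i \<in> {0..q}" for i
    using tangential_subdiff_attains_dir_deriv[OF reg(2)[OF that]] by (auto simp: D_def)
  have K_sup: "\<exists>k\<in>K. 0 \<le> k \<bullet> d" if "d \<in> closure ?T" for d
  proof (rule ccontr)
    assume neg: "\<not> ?thesis"
    have desc: "dir_deriv (h i) xstar d < 0" if "i \<in> A" for i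
    proof -
      have "i \<in> {0..q}" using A(2) that by blast
      then obtain \<xi> where "\<xi> \<in> D i" "\<xi> \<bullet> d = dir_deriv (h i) xstar d"
        unfolding D_def by (rule tangential_subdiff_attains_dir_deriv[OF reg(2)])
      moreover from this(1) that have "\<xi> \<in> K"
        unfolding K_def by (intro hull_inc) auto
      ultimately show ?thesis using neg by force
    qed
    \<comment> \<open>So far \<open>d\<close> lies only in the closure of the cone. Finite convex
      functions are continuous, so the common strict descent directions form an open set, which then
      also meets the cone itself.\<close>
    have "continuous_on UNIV (dir_deriv (h i) xstar)" if "i \<in> A" for i
      using reg(2) A(2) that
      by (intro convex_on_continuous) (auto simp: tangentially_convex_at_def)
    then have "open (\<Inter>i\<in>A. {v. dir_deriv (h i) xstar v < 0})" (is "open ?N")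
      using A(1) by (intro open_INT ballI open_Collect_less) auto
    moreover have "d \<in> ?N \<inter> closure ?T"
      using \<open>d \<in> closure ?T\<close> desc by simp
    ultimately have "?N \<inter> ?T \<noteq> {}"
      using open_Int_closure_eq_empty by blast
    then obtain v where v: "v \<in> ?T" "\<And>i. i \<in> A \<Longrightarrow> dir_deriv (h i) xstar v < 0"
      by blast
    show False
    proof (rule no_common_descent_direction[OF assms(2) _ _ _ _ _ v(1)])
      show "dir_deriv f xstar v < 0"
        using v(2)[of 0] A(3) by (simp add: h_def)
      show "dir_deriv (g j) xstar v < 0" if "j \<in> {1..q}" "g j xstar = 0" for j
        using v(2)[of j] that by (auto simp: A_def h_def)
      show "locally_lipschitz_at f xstar" "tangentially_convex_at f xstar"
        using reg[of 0] by (auto simp: h_def)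
      show "locally_lipschitz_at (g j) xstar" "tangentially_convex_at (g j) xstar"
        if "j \<in> {1..q}" for j
        using reg[of j] h_g[OF that] that by auto
    qed simp
  qed
  obtain k where "k \<in> K" and k_polar: "\<And>v. v \<in> ?T \<Longrightarrow> - k \<bullet> v \<le> 0"
    using compact_convex_meets_neg_polar[OF assms(5) cone_contingent_cone[OF xX] _ _
        \<open>compact K\<close> K_sup] zero_in_contingent_cone[OF xX] by (auto simp: K_def)
  have "- k \<in> limiting_normal_cone X xstar"
    using polar_contingent_cone_subset_frechet_normal_cone[OF k_polar]
      frechet_subset_limiting_normal_cone[OF xX] by blast
  \<comment> \<open>As the sets \<open>D i\<close> are convex and nonempty, one point from each
    suffices for a convex combination in the hull of their union.\<close>
  have "\<exists>c s. (\<forall>i\<in>A. 0 \<le> c i) \<and> sum c A = 1 \<and> (\<forall>i\<in>A. s i \<in> D i) \<and> k = (\<Sum>i\<in>A. c i *\<^sub>R s i)"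
    using \<open>k \<in> K\<close> A D_ne unfolding K_def
    by (subst (asm) convex_hull_finite_union) (auto simp: D_def convex_tangential_subdiff)
  then obtain c s where c: "\<And>i. i \<in> A \<Longrightarrow> 0 \<le> c i" "sum c A = 1"
    and s: "\<And>i. i \<in> A \<Longrightarrow> s i \<in> D i" and k: "k = (\<Sum>i\<in>A. c i *\<^sub>R s i)"
    by blast
  \<comment> \<open>Zero weights outside \<open>A\<close> give complementary slackness. Inactive
    constraints still need some subgradient, picked arbitrarily from the nonempty
    \<open>D i\<close>.\<close>
  define \<mu> where "\<mu> i = (if i \<in> A then c i else 0)" for i
  define \<xi> where "\<xi> i = (if i \<in> A then s i else (SOME \<zeta>. \<zeta> \<in> D i))" for i
  have \<xi>: "\<xi> i \<in> D i" if "i \<in> {0..q}" for i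
    using s D_ne[OF that] by (auto simp: \<xi>_def some_in_eq)
  have "k = (\<Sum>i\<in>{0..q}. \<mu> i *\<^sub>R \<xi> i)"
    unfolding k using A by (intro sum.mono_neutral_cong_left) (auto simp: \<mu>_def \<xi>_def)
  also have "\<dots> = \<mu> 0 *\<^sub>R \<xi> 0 + (\<Sum>j=1..q. \<mu> j *\<^sub>R \<xi> j)"
    by (simp add: sum.atLeast_Suc_atMost)
  finally have "0 = \<mu> 0 *\<^sub>R \<xi> 0 + (\<Sum>j=1..q. \<mu> j *\<^sub>R \<xi> j) + - k" by simp
  moreover have "\<exists>j\<in>{0..q}. \<mu> j \<noteq> 0"
  proof (rule ccontr)
    assume "\<not> ?thesis"
    then have "\<mu> i = 0" if "i \<in> A" for i
      using A(2) that by blast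
    then have "c i = 0" if "i \<in> A" for i
      using that by (force simp: \<mu>_def)
    with c(2) show False by simp
  qed
  moreover have "\<mu> j \<ge> 0" for j
    using c(1) by (simp add: \<mu>_def)
  moreover have "\<mu> j * g j xstar = 0" if "j \<in> {1..q}" for j
    using that by (auto simp: \<mu>_def A_def)
  moreover have "\<xi> 0 \<in> tangential_subdiff f xstar"
    using \<xi>[of 0] by (simp add: D_def h_def)
  moreover have "\<xi> j \<in> tangential_subdiff (g j) xstar" if "j \<in> {1..q}" for j
    using \<xi>[of j] that by (simp add: D_def h_g)
  ultimately show ?thesis
    using \<open>- k \<in> limiting_normal_cone X xstar\<close> by blast
qed

end
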